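(* For $n \in \mathbb{N}$ (including $n=0$), let $I_n = (\{v_1,\ldots,v_n\},\emptyset)$ be the graph with $n$ vertices and no edges. Then: (1) $I_n$ is $\chi$-vertex-stable for $n = 0$ and for $n \geq 2$; (2) $I_n$ is $\omega$-vertex-stable for $n = 0$ and for $n \geq 2$; (3) $I_n$ is $\beta$-vertex-stable (for all $n$); (4) $I_n$ is $\alpha$-vertex-stable only for $n = 0$; (5) $I_n$ is $\xi$-stable for every $\xi \in \{\alpha,\beta,\chi,\omega\}$ (for all $n$).
   Context: Graphs are finite, undirected, simple, without loops; the null graph (no vertices) is allowed. $\alpha(G)$ is the size of a maximum independent set, $\beta(G)$ the size of a minimum vertex cover, $\omega(G)$ the size of a maximum clique, $\chi(G)$ the chromatic number; all are $0$ on the null graph. For a parameter $\xi$, $G$ is $\xi$-stable if $\xi(G-e)=\xi(G)$ for every edge $e\in E(G)$ ($G-e$ is $G$ with $e$ deleted), and $\xi$-vertex-stable if $\xi(G-v)=\xi(G)$ for every vertex $v\in V(G)$ ($G-v$ is $G$ with $v$ and its incident edges deleted). *)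

theory Defs
  imports Main
begin

record 'a ugraph =
  verts :: "'a set"
  edges :: "'a set set"

definition simple_graph :: "'a ugraph \<Rightarrow> bool" where
  "simple_graph G \<longleftrightarrow> finite (verts G) \<and> (\<forall>e\<in>edges G. e \<subseteq> verts G \<and> card e = 2)"

definition del_edge :: "'a ugraph \<Rightarrow> 'a set \<Rightarrow> 'a ugraph" where
  "del_edge G e = \<lparr>verts = verts G, edges = edges G - {e}\<rparr>"

definition del_vertex :: "'a ugraph \<Rightarrow> 'a \<Rightarrow> 'a ugraph" where
  "del_vertex G v = \<lparr>verts = verts G - {v}, edges = {e \<in> edges G. v \<notin> e}\<rparr>"

definition independent_set :: "'a ugraph \<Rightarrow> 'a set \<Rightarrow> bool" where
  "independent_set G S \<longleftrightarrow> S \<subseteq> verts G \<and> (\<forall>x\<in>S. \<forall>y\<in>S. {x, y} \<notin> edges G)"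

definition vertex_cover :: "'a ugraph \<Rightarrow> 'a set \<Rightarrow> bool" where
  "vertex_cover G S \<longleftrightarrow> S \<subseteq> verts G \<and> (\<forall>e\<in>edges G. e \<inter> S \<noteq> {})"

definition clique :: "'a ugraph \<Rightarrow> 'a set \<Rightarrow> bool" where
  "clique G S \<longleftrightarrow> S \<subseteq> verts G \<and> (\<forall>x\<in>S. \<forall>y\<in>S. x \<noteq> y \<longrightarrow> {x, y} \<in> edges G)"

definition proper_colouring :: "'a ugraph \<Rightarrow> nat \<Rightarrow> ('a \<Rightarrow> nat) \<Rightarrow> bool" where
  "proper_colouring G k c \<longleftrightarrow>
     (\<forall>x\<in>verts G. c x < k) \<and>
     (\<forall>x\<in>verts G. \<forall>y\<in>verts G. {x, y} \<in> edges G \<longrightarrow> c x \<noteq> c y)"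

text \<open>On a simple graph the sets below are finite, and nonempty since the empty set is
  independent and a clique, and the whole vertex set is a vertex cover.\<close>

definition independence_number :: "'a ugraph \<Rightarrow> nat" where
  "independence_number G = Max (card ` {S. independent_set G S})"

definition vertex_cover_number :: "'a ugraph \<Rightarrow> nat" where
  "vertex_cover_number G = Min (card ` {S. vertex_cover G S})"

definition clique_number :: "'a ugraph \<Rightarrow> nat" where
  "clique_number G = Max (card ` {S. clique G S})"

definition chromatic_number :: "'a ugraph \<Rightarrow> nat" where
  "chromatic_number G = (LEAST k. \<exists>c. proper_colouring G k c)"

definition param_stable :: "('a ugraph \<Rightarrow> nat) \<Rightarrow> 'a ugraph \<Rightarrow> bool" where
  "param_stable \<xi> G \<longleftrightarrow> (\<forall>e\<in>edges G. \<xi> (del_edge G e) = \<xi> G)"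

definition param_vertex_stable :: "('a ugraph \<Rightarrow> nat) \<Rightarrow> 'a ugraph \<Rightarrow> bool" where
  "param_vertex_stable \<xi> G \<longleftrightarrow> (\<forall>v\<in>verts G. \<xi> (del_vertex G v) = \<xi> G)"

text \<open>The vertices are \<open>v 1, \<dots>, v n\<close>; there are exactly \<open>n\<close> of them when \<open>v\<close> is injective
  on \<open>{1..n}\<close>.\<close>

definition edgeless_graph :: "(nat \<Rightarrow> 'a) \<Rightarrow> nat \<Rightarrow> 'a ugraph" where
  "edgeless_graph v n = \<lparr>verts = v ` {1..n}, edges = {}\<rparr>"

lemma simple_graph_del_edge: "simple_graph G \<Longrightarrow> simple_graph (del_edge G e)"
  by (simp add: simple_graph_def del_edge_def)

lemma simple_graph_del_vertex: "simple_graph G \<Longrightarrow> simple_graph (del_vertex G v)"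
  by (auto simp: simple_graph_def del_vertex_def)

lemma simple_graph_edgeless: "simple_graph (edgeless_graph v n)"
  by (simp add: simple_graph_def edgeless_graph_def)

lemma null_graph_parameters:
  assumes "simple_graph G" and "verts G = {}"
  shows "independence_number G = 0" "vertex_cover_number G = 0"
    "clique_number G = 0" "chromatic_number G = 0"
proof -
  have E: "edges G = {}"
    using assms by (auto simp: simple_graph_def)
  have "{S. independent_set G S} = {{}}" "{S. vertex_cover G S} = {{}}" "{S. clique G S} = {{}}"
    using assms(2) E by (auto simp: independent_set_def vertex_cover_def clique_def)
  then show "independence_number G = 0" "vertex_cover_number G = 0" "clique_number G = 0"
    by (simp_all add: independence_number_def vertex_cover_number_def clique_number_def)
  have "proper_colouring G 0 c" for c
    using assms(2) by (simp add: proper_colouring_def)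
  then show "chromatic_number G = 0"
    unfolding chromatic_number_def by (intro Least_eq_0) blast
qed

end

theory Submission
  imports Defs
begin

text \<open>Without edges the parameters depend only on the vertices: \<alpha> is their number,
  \<beta> is 0, and \<omega> and \<chi> are both 1 as soon as there is a vertex. Deleting a vertex
  leaves the graph edgeless, so these values apply before and after. Hence \<beta> never changes,
  \<alpha> always drops by one, and \<omega> and \<chi> change only when the last vertex goes, that
  is, when n = 1. For n = 0 there is no vertex to delete, and there is never an edge to
  delete.\<close>

lemma independence_number_edgeless:
  assumes "edges G = {}" and "finite (verts G)"
  shows "independence_number G = card (verts G)"
  unfolding independence_number_def
proof (rule Max_eqI)
  show "finite (card ` {S. independent_set G S})"
    using assms(2) by (auto simp: independent_set_def intro: finite_subset[of _ "Pow (verts G)"])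
  show "y \<le> card (verts G)" if "y \<in> card ` {S. independent_set G S}" for y
    using that assms(2) by (auto simp: independent_set_def intro: card_mono)
  show "card (verts G) \<in> card ` {S. independent_set G S}"
    using assms(1) by (auto simp: independent_set_def)
qed

lemma vertex_cover_number_edgeless:
  assumes "edges G = {}" and "finite (verts G)"
  shows "vertex_cover_number G = 0"
  unfolding vertex_cover_number_def
proof (rule Min_eqI)
  show "finite (card ` {S. vertex_cover G S})"
    using assms(2) by (auto simp: vertex_cover_def intro: finite_subset[of _ "Pow (verts G)"])
  show "0 \<in> card ` {S. vertex_cover G S}"
    using assms(1) by (auto simp: vertex_cover_def intro!: image_eqI[of _ _ "{}"])
qed simp

lemma clique_number_edgeless:
  assumes "edges G = {}" and "finite (verts G)" and "verts G \<noteq> {}"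
  shows "clique_number G = 1"
  unfolding clique_number_def
proof (rule Max_eqI)
  show "finite (card ` {S. clique G S})"
    using assms(2) by (auto simp: clique_def intro: finite_subset[of _ "Pow (verts G)"])
  \<comment> \<open>Two distinct members of a clique would span an edge, so a clique here has at
    most one element.\<close>
  show "y \<le> 1" if "y \<in> card ` {S. clique G S}" for y
    using that assms(1,2) by (auto simp: clique_def card_le_Suc0_iff_eq finite_subset)
  obtain x where "x \<in> verts G"
    using assms(3) by blast
  then show "1 \<in> card ` {S. clique G S}"
    by (auto simp: clique_def intro!: image_eqI[of _ _ "{x}"])
qed

lemma chromatic_number_edgeless:
  assumes "edges G = {}" and "verts G \<noteq> {}"
  shows "chromatic_number G = 1"
  unfolding chromatic_number_def
proof (rule Least_equality)
  have "proper_colouring G 1 (\<lambda>_. 0)"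
    using assms(1) by (simp add: proper_colouring_def)
  then show "\<exists>c. proper_colouring G 1 c"
    by blast
  \<comment> \<open>Some vertex exists and its colour is a natural number below \<open>k\<close>,
    which excludes \<open>k = 0\<close>.\<close>
  show "1 \<le> k" if "\<exists>c. proper_colouring G k c" for k
    using that assms(2) by (fastforce simp: proper_colouring_def)
qed

theorem theorem6:
  fixes v :: "nat \<Rightarrow> 'a" and n :: nat
  assumes "inj_on v {1..n}"
  shows "(n = 0 \<or> n \<ge> 2 \<longrightarrow> param_vertex_stable chromatic_number (edgeless_graph v n))
       \<and> (n = 0 \<or> n \<ge> 2 \<longrightarrow> param_vertex_stable clique_number (edgeless_graph v n))
       \<and> param_vertex_stable vertex_cover_number (edgeless_graph v n)
       \<and> (param_vertex_stable independence_number (edgeless_graph v n) \<longleftrightarrow> n = 0)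
       \<and> (\<forall>\<xi>\<in>{independence_number, vertex_cover_number, chromatic_number, clique_number}.
            param_stable \<xi> (edgeless_graph v n))"
proof -
  let ?G = "edgeless_graph v n"
  have edges: "edges ?G = {}" "edges (del_vertex ?G x) = {}" for x
    by (simp_all add: edgeless_graph_def del_vertex_def)
  have finite: "finite (verts ?G)" "finite (verts (del_vertex ?G x))" for x
    by (simp_all add: edgeless_graph_def del_vertex_def)
  have card: "card (verts ?G) = n"
    using assms by (simp add: edgeless_graph_def card_image)
  have card_del: "card (verts (del_vertex ?G x)) = n - 1" if "x \<in> verts ?G" for x
    using that card by (simp add: del_vertex_def)
  have empty: "verts ?G = {} \<longleftrightarrow> n = 0"
    by (auto simp: edgeless_graph_def)
  \<comment> \<open>The values for \<omega> and \<chi> require a vertex both before and after the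
    deletion. The presence of \<open>x\<close> excludes n = 0, so n \<ge> 2 and at least one vertex
    survives.\<close>
  have nonempty: "verts ?G \<noteq> {}" "verts (del_vertex ?G x) \<noteq> {}"
    if "n = 0 \<or> n \<ge> 2" "x \<in> verts ?G" for x
  proof -
    show "verts ?G \<noteq> {}"
      using that(2) by blast
    then have "n \<ge> 2"
      using that(1) empty by blast
    then show "verts (del_vertex ?G x) \<noteq> {}"
      using card_del[OF that(2)] by auto
  qed
  have "param_vertex_stable chromatic_number ?G" if "n = 0 \<or> n \<ge> 2"
    unfolding param_vertex_stable_def
    using nonempty[OF that] by (metis chromatic_number_edgeless edges)
  moreover have "param_vertex_stable clique_number ?G" if "n = 0 \<or> n \<ge> 2"
    unfolding param_vertex_stable_def
    using nonempty[OF that] by (metis clique_number_edgeless edges finite)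
  moreover have "param_vertex_stable vertex_cover_number ?G"
    by (simp add: param_vertex_stable_def vertex_cover_number_edgeless edges finite)
  \<comment> \<open>If n > 0, some vertex can be deleted, and this turns \<alpha> from n into n - 1,
    a genuinely smaller number; if n = 0 the condition is vacuous.\<close>
  moreover have "param_vertex_stable independence_number ?G \<longleftrightarrow> n = 0"
    using empty
    by (auto simp: param_vertex_stable_def independence_number_edgeless edges finite card card_del)
  \<comment> \<open>Vacuous for any function \<xi>, since the condition ranges over an empty set of
    edges.\<close>
  moreover have "param_stable \<xi> ?G" for \<xi>
    by (simp add: param_stable_def edges)
  ultimately show ?thesis
    by blast
qed

end
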